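(* Let $(\bar x,\bar y)\in S_{\rm Lag}(\bar p)$, where $\bar p=(\bar w,0,0)$. For each $\nu=1,\dots,N$, let $f_\nu:\mathbb R^n\times\mathbb R^d\to\mathbb R$ and $F_\nu:\mathbb R^n\times\mathbb R^d\to\mathbb R^{m_\nu}$ be twice differentiable with respect to $x$ in a neighborhood of $(\bar x,\bar w)$, and suppose that $f_\nu$, $F_\nu$, $\nabla_xf_\nu$ and $\mathcal J_xF_\nu$ are strictly differentiable with respect to $(x,w)$ in this neighborhood. Then $S_{\rm Lag}$ has the isolated calmness property at $\bar p$ for $(\bar x,\bar y)$ if and only if the following implication holds for $d_x\in\mathbb R^n$ and vectors $[d_{y^\nu}]_{\alpha_\nu}\in\mathbb R^{|\alpha_\nu|}$, $[d_{y^\nu}]_{\beta_\nu}\in\mathbb R^{|\beta_\nu|}$, $\nu=1,\dots,N$: $$\left.\begin{array}{l}\mathbf Gd_x+\begin{pmatrix}\mathcal J_{x^1}g_{1,\alpha_1}(\bar x)^T[d_{y^1}]_{\alpha_1}+\mathcal J_{x^1}g_{1,\beta_1}(\bar x)^T[d_{y^1}]_{\beta_1}\\ \vdots\\ \mathcal J_{x^N}g_{N,\alpha_N}(\bar x)^T[d_{y^N}]_{\alpha_N}+\mathcal J_{x^N}g_{N,\beta_N}(\bar x)^T[d_{y^N}]_{\beta_N}\end{pmatrix}=0\\ \mathcal Jg_{\nu,\alpha_\nu}(\bar x)d_x=0,\ \nu=1,\dots,N\\ 0\ge\mathcal Jg_{\nu,\beta_\nu}(\bar x)d_x\perp[d_{y^\nu}]_{\beta_\nu}\ge0,\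 \nu=1,\dots,N\end{array}\right\}\Longrightarrow d_x=0,\ [d_{y^\nu}]_{\alpha_\nu\cup\beta_\nu}=0\ (\nu=1,\dots,N).$$
   Context: **Setting.** There are $N$ players, $n=n_1+\dots+n_N$, $x=(x^1,\dots,x^N)\in\mathbb R^n$ with $x^\nu\in\mathbb R^{n_\nu}$, and $x^{-\nu}$ denotes the other blocks. For each $\nu$, $K_\nu=\{0_{q_\nu}\}\times\mathbb R_-^{m_\nu-q_\nu}\subset\mathbb R^{m_\nu}$, so its polar is $K_\nu^\circ=\mathbb R^{q_\nu}\times\mathbb R_+^{m_\nu-q_\nu}$; $m=m_1+\dots+m_N$. Given $p=(w,v,u)\in\mathbb R^d\times\mathbb R^n\times\mathbb R^m$, player $\nu$ minimizes $f_\nu(x^\nu,x^{-\nu};w)-\langle v^\nu,x^\nu\rangle$ over $x^\nu\in\mathbb R^{n_\nu}$ subject to $F_\nu(x^\nu,x^{-\nu};w)-u^\nu\in K_\nu$. The set of Lagrangian generalized Nash equilibria is $$S_{\rm Lag}(p)=\{(x,y)\in\mathbb R^n\times\mathbb R^m:\ \nabla_{x^\nu}f_\nu(x;w)+\mathcal J_{x^\nu}F_\nu(x;w)^Ty^\nu-v^\nu=0,\ 0\in-F_\nu(x;w)+u^\nu+N_{K_\nu^\circ}(y^\nu),\ \nu=1,\dots,N\},$$ with $N_C$ the normal cone of convex analysis and $\mathcal J$ the Jacobian. **Notation.** Fix $\bar w\in\mathbb R^d$; $\theta_\nu=f_\nu(\cdot;\bar w)$, $g_\nu=F_\nu(\cdot;\bar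 w)$, $l_\nu(x,y^\nu)=\theta_\nu(x)+\langle y^\nu,g_\nu(x)\rangle$. $\mathbf G$ is the $n\times n$ matrix with $(\nu,\mu)$ block $\nabla^2_{x^\nu x^\mu}l_\nu(\bar x,\bar y^\nu)$ (derivative in $x^\mu$ of $\nabla_{x^\nu}l_\nu$). Index sets: $\alpha_\nu=\{1,\dots,q_\nu\}\cup\{i\in\{q_\nu+1,\dots,m_\nu\}:[g_\nu]_i(\bar x)=0<\bar y^\nu_i\}$, $\beta_\nu=\{i\in\{q_\nu+1,\dots,m_\nu\}:[g_\nu]_i(\bar x)=0=\bar y_i^\nu\}$. For an index set $I$, $g_{\nu,I}$ is the subvector of $g_\nu$ with indices in $I$; $\mathcal Jg_{\nu,I}$ is its Jacobian in all of $x$ and $\mathcal J_{x^\nu}g_{\nu,I}$ its Jacobian in $x^\nu$. The notation $0\ge a\perp b\ge0$ means $a\le0$, $b\ge0$ componentwise and $\langle a,b\rangle=0$. **Isolated calmness.** A set-valued $S$ has the isolated calmness property at $\bar a$ for $\bar b\in S(\bar a)$ if there are $\kappa>0$ and neighborhoods $V$ of $\bar a$, $W$ of $\bar b$ with $S(a)\cap W\subset\{\bar b\}+\kappa\|a-\bar a\|\mathbf B$ for all $a\in V$ ($\mathbf B$ the closed unit ball). *)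

theory Defs
  imports "HOL-Analysis.Analysis"
begin

text \<open>
  Players are the elements of a finite type \<open>'p\<close>.  The block structure of a vector
  \<open>z = (z\<^sup>\<nu>)\<^sub>\<nu>\<close> is given by a map assigning to each coordinate the player owning it:
  \<open>vp :: 'n \<Rightarrow> 'p\<close> for the variables \<open>x\<close>, \<open>cp :: 'm \<Rightarrow> 'p\<close> for the constraints and the
  multipliers \<open>y\<close>.  The set \<open>E :: 'm set\<close> collects the equality constraints of all players; the
  numbering that puts the equality constraints of each player first is immaterial.
  For an index set \<open>I\<close>, the space of vectors indexed by \<open>I\<close> is identified with the subspace
  \<open>coords I\<close> of vectors vanishing outside \<open>I\<close>; likewise submatrices are padded with zeros.
  All constraint functions are stacked into one map \<open>F\<close>, so that \<open>F\<^sub>\<nu>\<close> is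
  \<open>subvec (block cp \<nu>) (F x w)\<close>.
\<close>

definition block :: "('i \<Rightarrow> 'p) \<Rightarrow> 'p \<Rightarrow> 'i set" where
  "block own \<nu> = {i. own i = \<nu>}"

definition coords :: "'i set \<Rightarrow> (real ^ 'i) set" where
  "coords I = {z. \<forall>i. i \<notin> I \<longrightarrow> z $ i = 0}"

definition subvec :: "'i set \<Rightarrow> real ^ 'i \<Rightarrow> real ^ 'i" where
  "subvec I z = (\<chi> i. if i \<in> I then z $ i else 0)"

definition submat :: "'i set \<Rightarrow> 'j set \<Rightarrow> real ^ 'j ^ 'i \<Rightarrow> real ^ 'j ^ 'i" where
  "submat I J A = (\<chi> i j. if i \<in> I \<and> j \<in> J then A $ i $ j else 0)"

definition stack :: "('i \<Rightarrow> 'p) \<Rightarrow> ('p \<Rightarrow> real ^ 'i) \<Rightarrow> real ^ 'i" where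
  "stack own b = (\<chi> i. b (own i) $ i)"

definition grad :: "(real ^ 'n \<Rightarrow> real) \<Rightarrow> real ^ 'n \<Rightarrow> real ^ 'n" where
  "grad h x = (\<chi> i. frechet_derivative h (at x) (axis i 1))"

definition strictly_differentiable ::
    "('a::real_normed_vector \<Rightarrow> 'b::real_normed_vector) \<Rightarrow> 'a \<Rightarrow> bool" where
  "strictly_differentiable h a \<longleftrightarrow>
     (\<exists>D. bounded_linear D \<and>
       (\<forall>\<epsilon>>0. \<exists>\<delta>>0. \<forall>z\<in>ball a \<delta>. \<forall>z'\<in>ball a \<delta>.
          norm (h z - h z' - D (z - z')) \<le> \<epsilon> * norm (z - z')))"

definition isolated_calmness ::
    "('a::real_normed_vector \<Rightarrow> 'b::real_normed_vector set) \<Rightarrow> 'a \<Rightarrow> 'b \<Rightarrow> bool" where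
  "isolated_calmness S a0 b0 \<longleftrightarrow>
     b0 \<in> S a0 \<and>
     (\<exists>\<kappa>>0. \<exists>V W. open V \<and> a0 \<in> V \<and> open W \<and> b0 \<in> W \<and>
        (\<forall>a\<in>V. S a \<inter> W \<subseteq> {b0 + (\<kappa> * norm (a - a0)) *\<^sub>R u |u. u \<in> cball 0 1}))"

text \<open>Polar and normal cones are taken relative to an ambient subspace \<open>X\<close>, in which the sets lie.\<close>

definition polar_in :: "'a::real_inner set \<Rightarrow> 'a set \<Rightarrow> 'a set" where
  "polar_in X K = {y \<in> X. \<forall>z\<in>K. inner y z \<le> 0}"

definition normal_cone_in :: "'a::real_inner set \<Rightarrow> 'a set \<Rightarrow> 'a \<Rightarrow> 'a set" where
  "normal_cone_in X C y = (if y \<in> C then {v \<in> X. \<forall>z\<in>C. inner v (z - y) \<le> 0} else {})"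

definition K_cone :: "('m \<Rightarrow> 'p) \<Rightarrow> 'm set \<Rightarrow> 'p \<Rightarrow> (real ^ 'm) set" where
  "K_cone cp E \<nu> =
     {z \<in> coords (block cp \<nu>).
        (\<forall>i \<in> block cp \<nu> \<inter> E. z $ i = 0) \<and> (\<forall>i \<in> block cp \<nu> - E. z $ i \<le> 0)}"

definition K_polar :: "('m::finite \<Rightarrow> 'p) \<Rightarrow> 'm set \<Rightarrow> 'p \<Rightarrow> (real ^ 'm) set" where
  "K_polar cp E \<nu> = polar_in (coords (block cp \<nu>)) (K_cone cp E \<nu>)"

text \<open>The argument of \<open>S_Lag\<close> is the parameter \<open>p = (w, v, u)\<close>.\<close>

definition S_Lag ::
    "('n::finite \<Rightarrow> 'p) \<Rightarrow> ('m::finite \<Rightarrow> 'p) \<Rightarrow> 'm set \<Rightarrow>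
     ('p \<Rightarrow> real ^ 'n \<Rightarrow> real ^ 'd \<Rightarrow> real) \<Rightarrow> (real ^ 'n \<Rightarrow> real ^ 'd \<Rightarrow> real ^ 'm) \<Rightarrow>
     (real ^ 'd) \<times> (real ^ 'n) \<times> (real ^ 'm) \<Rightarrow> ((real ^ 'n) \<times> (real ^ 'm)) set" where
  "S_Lag vp cp E f F = (\<lambda>(w, v, u). {(x, y). \<forall>\<nu>.
       subvec (block vp \<nu>) (grad (\<lambda>x. f \<nu> x w) x)
         + transpose (submat (block cp \<nu>) (block vp \<nu>) (jacobian (\<lambda>x. F x w) (at x)))
             *v subvec (block cp \<nu>) y
         - subvec (block vp \<nu>) v = 0 \<and>
       0 \<in> {- subvec (block cp \<nu>) (F x w) + subvec (block cp \<nu>) u + z |z.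
              z \<in> normal_cone_in (coords (block cp \<nu>)) (K_polar cp E \<nu>)
                    (subvec (block cp \<nu>) y)}})"

definition player_lagrangian ::
    "('m::finite \<Rightarrow> 'p) \<Rightarrow> ('p \<Rightarrow> real ^ 'n \<Rightarrow> real) \<Rightarrow> (real ^ 'n \<Rightarrow> real ^ 'm) \<Rightarrow>
     'p \<Rightarrow> real ^ 'n \<Rightarrow> real ^ 'm \<Rightarrow> real" where
  "player_lagrangian cp \<theta> g \<nu> x y =
     \<theta> \<nu> x + inner (subvec (block cp \<nu>) y) (subvec (block cp \<nu>) (g x))"

text \<open>The rows of \<open>G\<close> belonging to player \<open>\<nu>\<close> are those of the Hessian of the Lagrangian of \<open>\<nu>\<close>.\<close>

definition G_matrix ::
    "('n::finite \<Rightarrow> 'p) \<Rightarrow> ('m::finite \<Rightarrow> 'p) \<Rightarrow> ('p \<Rightarrow> real ^ 'n \<Rightarrow> real) \<Rightarrow>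
     (real ^ 'n \<Rightarrow> real ^ 'm) \<Rightarrow> real ^ 'n \<Rightarrow> real ^ 'm \<Rightarrow> real ^ 'n ^ 'n" where
  "G_matrix vp cp \<theta> g x0 y0 =
     (\<chi> i j. jacobian (grad (\<lambda>x. player_lagrangian cp \<theta> g (vp i) x y0)) (at x0) $ i $ j)"

definition alpha_set ::
    "('m \<Rightarrow> 'p) \<Rightarrow> 'm set \<Rightarrow> (real ^ 'n \<Rightarrow> real ^ 'm) \<Rightarrow> real ^ 'n \<Rightarrow> real ^ 'm \<Rightarrow> 'p \<Rightarrow> 'm set" where
  "alpha_set cp E g x0 y0 \<nu> =
     (block cp \<nu> \<inter> E) \<union> {i \<in> block cp \<nu> - E. g x0 $ i = 0 \<and> 0 < y0 $ i}"

definition beta_set ::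
    "('m \<Rightarrow> 'p) \<Rightarrow> 'm set \<Rightarrow> (real ^ 'n \<Rightarrow> real ^ 'm) \<Rightarrow> real ^ 'n \<Rightarrow> real ^ 'm \<Rightarrow> 'p \<Rightarrow> 'm set" where
  "beta_set cp E g x0 y0 \<nu> = {i \<in> block cp \<nu> - E. g x0 $ i = 0 \<and> y0 $ i = 0}"

text \<open>The notation \<open>0 \<ge> a \<bottom> b \<ge> 0\<close>.\<close>

definition complementary :: "real ^ 'm \<Rightarrow> real ^ 'm \<Rightarrow> bool" where
  "complementary a b \<longleftrightarrow> (\<forall>i. a $ i \<le> 0) \<and> (\<forall>i. 0 \<le> b $ i) \<and> inner a b = 0"

end

theory Submission
  imports Defs
begin

text \<open>
  Evaluating the polar and normal cones coordinatewise turns \<open>S_Lag\<close> into the solution map of a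
  KKT system \<open>\<Phi>(x,w,y) = v\<close> with complementarity between \<open>F(x,w) - u\<close> and \<open>y\<close>, in which \<open>v\<close> and \<open>u\<close>
  are free.  If isolated calmness fails, normalised differences of solutions converge to a
  nonzero solution of the linearised system.  Conversely, along a nonzero solution \<open>(dx, dy)\<close> of the
  linearised system the points \<open>(x0 + t dx, y0 + t dy)\<close> solve the KKT system exactly for suitable
  \<open>v\<close> and \<open>u\<close> of size \<open>o(t)\<close>, so no implicit function theorem is needed, and isolated calmness fails.
\<close>

section \<open>Isolated calmness in terms of norms and sequences\<close>

text \<open>Scaling the unit ball by \<open>r\<close> gives the closed ball of radius
  \<open>r\<close>. The radius \<open>r = 0\<close>, which occurs at \<open>a = a0\<close>, is
  treated separately because one cannot divide by it.\<close>

lemma isolated_calmness_iff_norm: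
  "isolated_calmness S a0 b0 \<longleftrightarrow> b0 \<in> S a0 \<and>
     (\<exists>\<kappa>>0. \<exists>V W. open V \<and> a0 \<in> V \<and> open W \<and> b0 \<in> W \<and>
        (\<forall>a\<in>V. \<forall>b\<in>S a \<inter> W. norm (b - b0) \<le> \<kappa> * norm (a - a0)))"
proof -
  have "b \<in> {b0 + r *\<^sub>R u |u. u \<in> cball 0 1} \<longleftrightarrow> norm (b - b0) \<le> r" if "r \<ge> 0" for r b
  proof
    assume "b \<in> {b0 + r *\<^sub>R u |u. u \<in> cball 0 1}"
    then show "norm (b - b0) \<le> r"
      using that by (auto simp: mult_left_le)
  next
    assume le: "norm (b - b0) \<le> r"
    show "b \<in> {b0 + r *\<^sub>R u |u. u \<in> cball 0 1}"
    proof (cases "r = 0")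
      case True
      then show ?thesis using le by (auto intro: exI[of _ 0])
    next
      case False
      then have "b = b0 + r *\<^sub>R ((b - b0) /\<^sub>R r)" "norm ((b - b0) /\<^sub>R r) \<le> 1"
        using le that by (simp, simp add: divide_simps)
      then show ?thesis
        by (metis (mono_tags, lifting) mem_Collect_eq mem_cball_0)
    qed
  qed
  then show ?thesis
    unfolding isolated_calmness_def by (simp add: subset_eq cong: conj_cong)
qed

text \<open>Calmness is refuted with the constant \<open>Suc n\<close> and balls of radius
  \<open>1 / Suc n\<close>. The violated estimate says exactly that the parameter moves by a smaller
  order than the solution, which gives the last limit.\<close>

lemma not_isolated_calmness_sequences:
  assumes "b0 \<in> S a0" "\<not> isolated_calmness S a0 b0"
  obtains a b where "a \<longlonglongrightarrow> a0" "b \<longlonglongrightarrow> b0" "\<And>n. b n \<in> S (a n)" "\<And>n. b n \<noteq> b0"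
    "(\<lambda>n. (a n - a0) /\<^sub>R norm (b n - b0)) \<longlonglongrightarrow> 0"
proof -
  define e where "e n = inverse (real (Suc n))" for n
  have e: "e n > 0" "e \<longlonglongrightarrow> 0" for n
    unfolding e_def by (simp, rule LIMSEQ_inverse_real_of_nat)
  have "\<exists>a b. a \<in> ball a0 (e n) \<and> b \<in> S a \<and> b \<in> ball b0 (e n) \<and>
      norm (b - b0) > real (Suc n) * norm (a - a0)" for n
  proof (rule ccontr)
    assume "\<not> ?thesis"
    then have "\<forall>a\<in>ball a0 (e n). \<forall>b\<in>S a \<inter> ball b0 (e n). norm (b - b0) \<le> real (Suc n) * norm (a - a0)"
      by (meson IntE not_less)
    then have "isolated_calmness S a0 b0"
      unfolding isolated_calmness_iff_norm using assms(1) e(1)[of n]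
      by (intro conjI exI[of _ "real (Suc n)"] exI[of _ "ball a0 (e n)"] exI[of _ "ball b0 (e n)"]) auto
    with assms(2) show False ..
  qed
  then obtain a b where ab: "\<And>n. a n \<in> ball a0 (e n)" "\<And>n. b n \<in> S (a n)" "\<And>n. b n \<in> ball b0 (e n)"
      "\<And>n. norm (b n - b0) > real (Suc n) * norm (a n - a0)"
    by metis
  have "a \<longlonglongrightarrow> a0"
    using ab(1) by (intro metric_tendsto_imp_tendsto[OF e(2)])
      (auto simp: dist_commute less_imp_le intro!: always_eventually order.trans[OF less_imp_le abs_ge_self])
  moreover have "b \<longlonglongrightarrow> b0"
    using ab(3) by (intro metric_tendsto_imp_tendsto[OF e(2)])
      (auto simp: dist_commute less_imp_le intro!: always_eventually order.trans[OF less_imp_le abs_ge_self])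
  moreover have ne: "b n \<noteq> b0" for n
  proof -
    have "0 \<le> real (Suc n) * norm (a n - a0)" by simp
    with ab(4)[of n] have "norm (b n - b0) > 0" by linarith
    then show ?thesis by simp
  qed
  moreover have "(\<lambda>n. (a n - a0) /\<^sub>R norm (b n - b0)) \<longlonglongrightarrow> 0"
  proof (rule tendsto_norm_zero_cancel, rule tendsto_sandwich[OF _ _ tendsto_const e(2)])
    show "\<forall>\<^sub>F n in sequentially. norm ((a n - a0) /\<^sub>R norm (b n - b0)) \<le> e n"
    proof (intro always_eventually allI)
      fix n
      have "norm (b n - b0) > 0" using ne by simp
      then show "norm ((a n - a0) /\<^sub>R norm (b n - b0)) \<le> e n"
        using less_imp_le[OF ab(4)[of n]] by (simp add: e_def divide_simps mult_ac del: of_nat_Suc)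
    qed
  qed auto
  ultimately show ?thesis using that ab(2) by blast
qed

text \<open>A sequential form of the directional derivative. The scale \<open>t n\<close> is
  independent of \<open>norm (z n - z0)\<close>, so that several maps with different arguments can
  share one scale.\<close>

lemma has_derivative_quotient_tendsto:
  assumes h: "(h has_derivative D) (at z0)" and z: "z \<longlonglongrightarrow> z0"
    and d: "(\<lambda>n. (z n - z0) /\<^sub>R t n) \<longlonglongrightarrow> d" and t: "\<And>n. t n > 0"
  shows "(\<lambda>n. (h (z n) - h z0) /\<^sub>R t n) \<longlonglongrightarrow> D d"
proof -
  interpret D: bounded_linear D using h by (rule has_derivative_bounded_linear)
  \<comment> \<open>The normalised remainder has the value 0 at \<open>z0\<close> because
    \<open>inverse 0 = 0\<close>. It is therefore continuous there, and terms with
    \<open>z n = z0\<close> are permitted.\<close>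
  define R where "R y = (h y - h z0 - D (y - z0)) /\<^sub>R norm (y - z0)" for y
  have "(R \<longlongrightarrow> 0) (at z0)"
    using h unfolding has_derivative_at_within R_def by simp
  then have "isCont R z0" by (simp add: isCont_def R_def)
  then have "(\<lambda>n. R (z n)) \<longlonglongrightarrow> R z0" using z by (rule isCont_tendsto_compose)
  then have R: "(\<lambda>n. R (z n)) \<longlonglongrightarrow> 0" by (simp add: R_def)
  have "(\<lambda>n. norm ((z n - z0) /\<^sub>R t n) *\<^sub>R R (z n) + D ((z n - z0) /\<^sub>R t n)) \<longlonglongrightarrow> norm d *\<^sub>R 0 + D d"
    by (intro tendsto_intros d R D.tendsto)
  moreover have "norm ((z n - z0) /\<^sub>R t n) *\<^sub>R R (z n) + D ((z n - z0) /\<^sub>R t n) = (h (z n) - h z0) /\<^sub>R t n" for n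
  proof (cases "z n = z0")
    case True
    then show ?thesis by (simp add: D.zero)
  next
    case False
    have norm: "norm ((z n - z0) /\<^sub>R t n) = norm (z n - z0) * inverse (t n)"
      using t[of n] by simp
    have cancel: "norm (z n - z0) * inverse (t n) * inverse (norm (z n - z0)) = inverse (t n)"
      using False by simp
    show ?thesis
      unfolding norm D.scaleR R_def scaleR_scaleR cancel by (simp add: scaleR_diff_right)
  qed
  ultimately show ?thesis by simp
qed

section \<open>Abstract KKT systems and their linearisation\<close>

text \<open>The players are forgotten here: \<open>\<Phi>\<close> stands for all stationarity
  conditions together. The parameters \<open>v\<close> and \<open>u\<close> enter only as right-hand
  sides, and multipliers of indices in \<open>E\<close> have no sign restriction.\<close>

definition kkt_solutions ::
    "'m set \<Rightarrow> ('x \<Rightarrow> 'w \<Rightarrow> real ^ 'm \<Rightarrow> 'v) \<Rightarrow> ('x \<Rightarrow> 'w \<Rightarrow> real ^ 'm) \<Rightarrow>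
     'w \<times> 'v \<times> (real ^ 'm) \<Rightarrow> ('x \<times> (real ^ 'm)) set" where
  "kkt_solutions E \<Phi> F = (\<lambda>(w, v, u). {(x, y). \<Phi> x w y = v \<and>
     (\<forall>k. if k \<in> E then F x w $ k = u $ k
          else F x w $ k \<le> u $ k \<and> 0 \<le> y $ k \<and> y $ k * (F x w $ k - u $ k) = 0)})"

text \<open>At the reference point, this set and \<open>weakly_active\<close> are the unions over
  all players of the index sets \<alpha> and \<beta>.\<close>

definition strongly_active :: "'m set \<Rightarrow> real ^ 'm \<Rightarrow> real ^ 'm \<Rightarrow> 'm set" where
  "strongly_active E c y = E \<union> {k. c $ k = 0 \<and> 0 < y $ k}"

definition weakly_active :: "'m set \<Rightarrow> real ^ 'm \<Rightarrow> real ^ 'm \<Rightarrow> 'm set" where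
  "weakly_active E c y = {k. k \<notin> E \<and> c $ k = 0 \<and> y $ k = 0}"

text \<open>\<open>dc\<close> stands for the derivative of the constraints along the direction \<open>dx\<close>.\<close>

definition critical :: "'m set \<Rightarrow> real ^ 'm \<Rightarrow> real ^ 'm \<Rightarrow> real ^ 'm \<Rightarrow> real ^ 'm \<Rightarrow> bool" where
  "critical E c y dc dy \<longleftrightarrow>
     (\<forall>k\<in>strongly_active E c y. dc $ k = 0) \<and>
     (\<forall>k\<in>weakly_active E c y. dc $ k \<le> 0 \<and> 0 \<le> dy $ k \<and> dy $ k * dc $ k = 0) \<and>
     (\<forall>k. k \<notin> strongly_active E c y \<union> weakly_active E c y \<longrightarrow> dy $ k = 0)"

text \<open>Calmness compares solutions only with the single point \<open>(x0, y0)\<close>, so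
  derivatives at that point decide it. The \<open>w\<close> component of the direction is 0: in one
  half of the proof \<open>w\<close> moves by a smaller order than \<open>(x, y)\<close>, in the
  other it stays at \<open>w0\<close>.\<close>

theorem isolated_calmness_kkt_iff:
  fixes \<Phi> :: "'x::euclidean_space \<Rightarrow> 'w::real_normed_vector \<Rightarrow> real ^ 'm::finite \<Rightarrow> 'v::real_normed_vector"
  assumes sol: "(x0, y0) \<in> kkt_solutions E \<Phi> F (w0, 0, 0)"
    and \<Phi>: "((\<lambda>(x, w, y). \<Phi> x w y) has_derivative D\<Phi>) (at (x0, w0, y0))"
    and F: "((\<lambda>(x, w). F x w) has_derivative DF) (at (x0, w0))"
  shows "isolated_calmness (kkt_solutions E \<Phi> F) (w0, 0, 0) (x0, y0) \<longleftrightarrow>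
    (\<forall>dx dy. D\<Phi> (dx, 0, dy) = 0 \<and> critical E (F x0 w0) y0 (DF (dx, 0)) dy \<longrightarrow> dx = 0 \<and> dy = 0)"
    (is "?calm \<longleftrightarrow> ?crit")
proof
  have sol': "\<Phi> x0 w0 y0 = 0" "k \<in> E \<Longrightarrow> F x0 w0 $ k = 0"
      "k \<notin> E \<Longrightarrow> F x0 w0 $ k \<le> 0 \<and> 0 \<le> y0 $ k \<and> y0 $ k * F x0 w0 $ k = 0" for k
    using sol unfolding kkt_solutions_def by (simp_all split: if_splits) blast
  note act = strongly_active_def weakly_active_def
  have inactive: "k \<notin> E \<and> F x0 w0 $ k < 0 \<and> y0 $ k = 0"
    if "k \<notin> strongly_active E (F x0 w0) y0 \<union> weakly_active E (F x0 w0) y0" for k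
    using sol'(2,3)[of k] that by (cases "k \<in> E") (auto simp: act)
  {
    assume crit: ?crit
    show ?calm
    proof (rule ccontr)
      assume not_calm: "\<not> ?calm"
      obtain a b where a: "a \<longlonglongrightarrow> (w0, 0, 0)" and b: "b \<longlonglongrightarrow> (x0, y0)"
        and S: "\<And>n. b n \<in> kkt_solutions E \<Phi> F (a n)" and ne: "\<And>n. b n \<noteq> (x0, y0)"
        and quot: "(\<lambda>n. (a n - (w0, 0, 0)) /\<^sub>R norm (b n - (x0, y0))) \<longlonglongrightarrow> 0"
        by (rule not_isolated_calmness_sequences[OF sol not_calm]) (rule that)
      \<comment> \<open>Compactness of the unit sphere supplies a limit direction \<open>d\<close>
        of norm 1. The implication will force \<open>d = 0\<close>, a contradiction.\<close>
      have sphere: "(b n - (x0, y0)) /\<^sub>R norm (b n - (x0, y0)) \<in> sphere 0 1" for n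
        using ne by simp
      obtain d r where d: "d \<in> sphere 0 (1::real)" and r: "strict_mono r"
        and lim: "((\<lambda>n. (b n - (x0, y0)) /\<^sub>R norm (b n - (x0, y0))) \<circ> r) \<longlonglongrightarrow> d"
        using sphere
        by (rule seq_compactE[OF compact_sphere[unfolded compact_eq_seq_compact_metric], rule_format])
          (rule that)
      obtain dx dy where d_eq: "d = (dx, dy)" by fastforce
      define w v u x y t where
        "w n = fst (a (r n))" and "v n = fst (snd (a (r n)))" and "u n = snd (snd (a (r n)))"
        and "x n = fst (b (r n))" and "y n = snd (b (r n))" and "t n = norm (b (r n) - (x0, y0))" for n
      have t: "t n > 0" for n using ne by (simp add: t_def)
      have "(\<lambda>n. a (r n)) \<longlonglongrightarrow> (w0, 0, 0)" "(\<lambda>n. b (r n)) \<longlonglongrightarrow> (x0, y0)"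
        using LIMSEQ_subseq_LIMSEQ[OF a r] LIMSEQ_subseq_LIMSEQ[OF b r] by (auto simp: o_def)
      note lims = tendsto_fst[OF this(1)] tendsto_fst[OF tendsto_snd[OF this(1)]]
        tendsto_snd[OF tendsto_snd[OF this(1)]] tendsto_fst[OF this(2)] tendsto_snd[OF this(2)]
      have w: "w \<longlonglongrightarrow> w0" and v: "v \<longlonglongrightarrow> 0" and u: "u \<longlonglongrightarrow> 0" and x: "x \<longlonglongrightarrow> x0" and y: "y \<longlonglongrightarrow> y0"
        using lims by (simp_all add: w_def[abs_def] v_def[abs_def] u_def[abs_def] x_def[abs_def] y_def[abs_def])
      have "(\<lambda>n. (a (r n) - (w0, 0, 0)) /\<^sub>R t n) \<longlonglongrightarrow> 0"
        using LIMSEQ_subseq_LIMSEQ[OF quot r] by (simp add: o_def t_def)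
      note qlims = tendsto_fst[OF this] tendsto_fst[OF tendsto_snd[OF this]]
        tendsto_snd[OF tendsto_snd[OF this]]
      have qw: "(\<lambda>n. (w n - w0) /\<^sub>R t n) \<longlonglongrightarrow> 0" and qv: "(\<lambda>n. v n /\<^sub>R t n) \<longlonglongrightarrow> 0"
        and qu: "(\<lambda>n. u n /\<^sub>R t n) \<longlonglongrightarrow> 0"
        using qlims by (simp_all add: w_def v_def u_def)
      have lim': "(\<lambda>n. (b (r n) - (x0, y0)) /\<^sub>R t n) \<longlonglongrightarrow> (dx, dy)"
        using lim by (simp add: o_def t_def d_eq)
      have qx: "(\<lambda>n. (x n - x0) /\<^sub>R t n) \<longlonglongrightarrow> dx" and qy: "(\<lambda>n. (y n - y0) /\<^sub>R t n) \<longlonglongrightarrow> dy"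
        using tendsto_fst[OF lim'] tendsto_snd[OF lim'] by (simp_all add: x_def y_def)
      have S': "\<Phi> (x n) (w n) (y n) = v n" "k \<in> E \<Longrightarrow> F (x n) (w n) $ k = u n $ k"
        "k \<notin> E \<Longrightarrow> F (x n) (w n) $ k \<le> u n $ k \<and> 0 \<le> y n $ k \<and> y n $ k * (F (x n) (w n) $ k - u n $ k) = 0" for n k
        using S[of "r n"] unfolding kkt_solutions_def w_def v_def u_def x_def y_def case_prod_unfold
        by (simp_all split: if_splits)
      have "(\<lambda>n. ((case (x n, w n, y n) of (x, w, y) \<Rightarrow> \<Phi> x w y) - (case (x0, w0, y0) of (x, w, y) \<Rightarrow> \<Phi> x w y)) /\<^sub>R t n)
           \<longlonglongrightarrow> D\<Phi> (dx, 0, dy)"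
        by (rule has_derivative_quotient_tendsto[OF \<Phi> _ _ t])
          (auto intro!: tendsto_Pair w x y qw qx qy)
      then have "(\<lambda>n. v n /\<^sub>R t n) \<longlonglongrightarrow> D\<Phi> (dx, 0, dy)"
        by (simp add: sol'(1) S'(1))
      then have D\<Phi>: "D\<Phi> (dx, 0, dy) = 0" using qv LIMSEQ_unique by blast
      have "(\<lambda>n. ((case (x n, w n) of (x, w) \<Rightarrow> F x w) - (case (x0, w0) of (x, w) \<Rightarrow> F x w)) /\<^sub>R t n)
           \<longlonglongrightarrow> DF (dx, 0)"
        by (rule has_derivative_quotient_tendsto[OF F _ _ t]) (auto intro!: tendsto_Pair w x qw qx)
      then have qF: "(\<lambda>n. (F (x n) (w n) - F x0 w0) /\<^sub>R t n) \<longlonglongrightarrow> DF (dx, 0)" by simp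
      \<comment> \<open>The slack relative to the perturbed bound. Since \<open>u n\<close> is of
        smaller order than \<open>t n\<close>, its quotients have the same limit as those of the
        constraint map.\<close>
      define s where "s n = F (x n) (w n) - u n" for n
      have qs: "(\<lambda>n. (s n $ k - F x0 w0 $ k) / t n) \<longlonglongrightarrow> DF (dx, 0) $ k" for k
        using tendsto_vec_nth[OF tendsto_diff[OF qF qu], of k] by (simp add: s_def divide_inverse algebra_simps)
      have "isCont (\<lambda>(x, w). F x w) (x0, w0)" using F by (rule has_derivative_continuous)
      from isCont_tendsto_compose[OF this tendsto_Pair[OF x w]]
      have "(\<lambda>n. F (x n) (w n)) \<longlonglongrightarrow> F x0 w0" by simp
      from tendsto_vec_nth[OF tendsto_diff[OF this u]]
      have s: "(\<lambda>n. s n $ k) \<longlonglongrightarrow> F x0 w0 $ k" for k by (simp add: s_def)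
      have qy': "(\<lambda>n. (y n $ k - y0 $ k) / t n) \<longlonglongrightarrow> dy $ k" for k
        using tendsto_vec_nth[OF qy, of k] by (simp add: divide_inverse algebra_simps)
      have "critical E (F x0 w0) y0 (DF (dx, 0)) dy"
        unfolding critical_def
      proof (intro conjI ballI allI impI)
        \<comment> \<open>The slack is eventually zero: by feasibility on \<open>E\<close>, and
          otherwise because a positive multiplier stays positive near \<open>y0\<close> and
          complementarity then makes the constraint tight.\<close>
        fix k assume k: "k \<in> strongly_active E (F x0 w0) y0"
        have "\<forall>\<^sub>F n in sequentially. s n $ k = 0"
        proof (cases "k \<in> E")
          case True
          then show ?thesis by (simp add: s_def S'(2))
        next
          case False
          then have "y0 $ k > 0" using k by (auto simp: act)
          from order_tendstoD(1)[OF tendsto_vec_nth[OF y] this] show ?thesis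
          proof eventually_elim
            case (elim n)
            then show ?case using S'(3)[OF False, of n] by (simp add: s_def)
          qed
        qed
        then have "\<forall>\<^sub>F n in sequentially. (s n $ k - F x0 w0 $ k) / t n = 0"
        proof eventually_elim
          case (elim n)
          moreover have "F x0 w0 $ k = 0" using k sol'(2) by (auto simp: act)
          ultimately show ?case by simp
        qed
        from tendsto_eventually[OF this] show "DF (dx, 0) $ k = 0"
          by (rule LIMSEQ_unique[OF qs])
      next
        fix k assume "k \<in> weakly_active E (F x0 w0) y0"
        then have kE: "k \<notin> E" and k0: "F x0 w0 $ k = 0" "y0 $ k = 0" by (auto simp: act)
        have qs0: "(\<lambda>n. s n $ k / t n) \<longlonglongrightarrow> DF (dx, 0) $ k" and qy0: "(\<lambda>n. y n $ k / t n) \<longlonglongrightarrow> dy $ k"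
          using qs[of k] qy'[of k] by (simp_all add: k0)
        have sy: "s n $ k \<le> 0" "0 \<le> y n $ k" "y n $ k * s n $ k = 0" for n
          using S'(3)[OF kE, of n] by (auto simp: s_def)
        show "DF (dx, 0) $ k \<le> 0"
          by (rule LIMSEQ_le_const2[OF qs0]) (use sy t in \<open>auto simp: divide_le_0_iff less_imp_le\<close>)
        show "0 \<le> dy $ k"
          by (rule LIMSEQ_le_const[OF qy0]) (use sy t in \<open>auto simp: less_imp_le\<close>)
        \<comment> \<open>Complementarity is homogeneous here, since both reference values are 0.
          Dividing each factor by \<open>t n\<close> preserves it, and it passes to the
          limit.\<close>
        have "(\<lambda>n. (y n $ k / t n) * (s n $ k / t n)) = (\<lambda>n. 0)" using sy(3) by auto
        then show "dy $ k * DF (dx, 0) $ k = 0"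
          using tendsto_mult[OF qy0 qs0] by (simp add: LIMSEQ_const_iff)
      next
        fix k assume "k \<notin> strongly_active E (F x0 w0) y0 \<union> weakly_active E (F x0 w0) y0"
        then have k: "k \<notin> E" "F x0 w0 $ k < 0" "y0 $ k = 0" using inactive by auto
        \<comment> \<open>A strictly negative slack stays negative, so complementarity forces the
          multiplier to be 0.\<close>
        from order_tendstoD(2)[OF s k(2)]
        have "\<forall>\<^sub>F n in sequentially. (y n $ k - y0 $ k) / t n = 0"
        proof eventually_elim
          case (elim n)
          then show ?case using S'(3)[OF k(1), of n] k(3) by (auto simp: s_def)
        qed
        from tendsto_eventually[OF this] show "dy $ k = 0"
          by (rule LIMSEQ_unique[OF qy'])
      qed
      with crit D\<Phi> have "d = 0" by (simp add: d_eq zero_prod_def)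
      with d show False by simp
    qed
  next
    assume ?calm
    then obtain \<kappa> V W where "open V" "(w0, 0, 0) \<in> V" "open W" "(x0, y0) \<in> W"
      and calm: "\<And>a b. a \<in> V \<Longrightarrow> b \<in> kkt_solutions E \<Phi> F a \<Longrightarrow> b \<in> W \<Longrightarrow>
          norm (b - (x0, y0)) \<le> \<kappa> * norm (a - (w0, 0, 0))"
      unfolding isolated_calmness_iff_norm by (metis IntI)
    show ?crit
    proof (intro allI impI, elim conjE)
      fix dx dy assume D\<Phi>: "D\<Phi> (dx, 0, dy) = 0" and crit: "critical E (F x0 w0) y0 (DF (dx, 0)) dy"
      define t where "t n = inverse (real (Suc n))" for n
      have t: "t n > 0" and t0: "t \<longlonglongrightarrow> 0" for n
        unfolding t_def by (simp, rule LIMSEQ_inverse_real_of_nat)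
      define A where "A = strongly_active E (F x0 w0) y0 \<union> weakly_active E (F x0 w0) y0"
      define x where "x n = x0 + t n *\<^sub>R dx" for n
      define y where "y n = y0 + t n *\<^sub>R dy" for n
      \<comment> \<open>Taking the residual of the stationarity equation as \<open>v n\<close> makes
        this equation hold exactly.\<close>
      define v where "v n = \<Phi> (x n) w0 (y n)" for n
      \<comment> \<open>Makes \<open>F (x n) w0 - u n\<close> equal to its linearisation on the active constraints.\<close>
      define u :: "nat \<Rightarrow> real ^ 'm" where
        "u n = (\<chi> k. if k \<in> A then F (x n) w0 $ k - t n * DF (dx, 0) $ k else 0)" for n
      have x: "x \<longlonglongrightarrow> x0" and y: "y \<longlonglongrightarrow> y0"
        using tendsto_add[OF tendsto_const tendsto_scaleR[OF t0 tendsto_const], of x0 dx]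
          tendsto_add[OF tendsto_const tendsto_scaleR[OF t0 tendsto_const], of y0 dy]
        by (simp_all add: x_def[abs_def] y_def[abs_def])
      have qx: "(\<lambda>n. (x n - x0) /\<^sub>R t n) \<longlonglongrightarrow> dx" and qy: "(\<lambda>n. (y n - y0) /\<^sub>R t n) \<longlonglongrightarrow> dy"
        using t by (simp_all add: x_def y_def less_imp_neq[THEN not_sym])
      have "(\<lambda>n. ((case (x n, w0, y n) of (x, w, y) \<Rightarrow> \<Phi> x w y) - (case (x0, w0, y0) of (x, w, y) \<Rightarrow> \<Phi> x w y)) /\<^sub>R t n)
           \<longlonglongrightarrow> D\<Phi> (dx, 0, dy)"
        by (rule has_derivative_quotient_tendsto[OF \<Phi> _ _ t])
          (auto intro!: tendsto_Pair x y qx qy)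
      then have qv: "(\<lambda>n. v n /\<^sub>R t n) \<longlonglongrightarrow> 0"
        by (simp add: sol'(1) v_def D\<Phi>)
      have "(\<lambda>n. ((case (x n, w0) of (x, w) \<Rightarrow> F x w) - (case (x0, w0) of (x, w) \<Rightarrow> F x w)) /\<^sub>R t n)
           \<longlonglongrightarrow> DF (dx, 0)"
        by (rule has_derivative_quotient_tendsto[OF F _ _ t]) (auto intro!: tendsto_Pair x qx)
      then have qF: "(\<lambda>n. (F (x n) w0 - F x0 w0) /\<^sub>R t n) \<longlonglongrightarrow> DF (dx, 0)" by simp
      \<comment> \<open>On \<open>A\<close> the constraint value at the reference point is 0, so
        \<open>u n\<close> is a first-order Taylor remainder and hence of smaller order than
        \<open>t n\<close>.\<close>
      have qu: "(\<lambda>n. u n /\<^sub>R t n) \<longlonglongrightarrow> 0"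
      proof (rule vec_tendstoI)
        fix k
        show "(\<lambda>n. (u n /\<^sub>R t n) $ k) \<longlonglongrightarrow> 0 $ k"
        proof (cases "k \<in> A")
          case True
          then have "F x0 w0 $ k = 0" using sol'(2) by (auto simp: A_def act)
          then show ?thesis
            using True tendsto_diff[OF tendsto_vec_nth[OF qF, of k] tendsto_const[of "DF (dx, 0) $ k"]] t
            by (simp add: u_def field_simps less_imp_neq[THEN not_sym])
        next
          case False
          then show ?thesis by (simp add: u_def)
        qed
      qed
      have v: "v \<longlonglongrightarrow> 0" and u: "u \<longlonglongrightarrow> 0"
        using tendsto_scaleR[OF t0 qv] tendsto_scaleR[OF t0 qu] t by (simp_all add: less_imp_neq[THEN not_sym])
      have "isCont (\<lambda>(x, w). F x w) (x0, w0)" using F by (rule has_derivative_continuous)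
      from isCont_tendsto_compose[OF this tendsto_Pair[OF x tendsto_const]]
      have Fx: "(\<lambda>n. F (x n) w0) \<longlonglongrightarrow> F x0 w0" by simp
      have "(\<lambda>n. (w0, v n, u n)) \<longlonglongrightarrow> (w0, 0, 0)" by (intro tendsto_Pair tendsto_const v u)
      then have evV: "\<forall>\<^sub>F n in sequentially. (w0, v n, u n) \<in> V"
        using \<open>open V\<close> \<open>(w0, 0, 0) \<in> V\<close> by (rule topological_tendstoD)
      have evW: "\<forall>\<^sub>F n in sequentially. (x n, y n) \<in> W"
        using tendsto_Pair[OF x y] \<open>open W\<close> \<open>(x0, y0) \<in> W\<close> by (rule topological_tendstoD)
      have "\<forall>\<^sub>F n in sequentially. if k \<in> E then F (x n) w0 $ k = u n $ k
          else F (x n) w0 $ k \<le> u n $ k \<and> 0 \<le> y n $ k \<and> y n $ k * (F (x n) w0 $ k - u n $ k) = 0" for k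
      proof -
        consider "k \<in> strongly_active E (F x0 w0) y0" | "k \<in> weakly_active E (F x0 w0) y0"
          | "k \<notin> A" by (auto simp: A_def)
        then show ?thesis
        proof cases
          case 1
          \<comment> \<open>By \<open>critical\<close> the linearisation is zero on strongly active
            indices, so the slack vanishes exactly. Only the sign of a positive multiplier has to
            persist, which holds for large \<open>n\<close>.\<close>
          then have eq: "F (x n) w0 $ k = u n $ k" for n
            using crit by (auto simp: u_def A_def critical_def)
          show ?thesis
          proof (cases "k \<in> E")
            case True
            then show ?thesis by (simp add: eq)
          next
            case False
            then have "y0 $ k > 0" using 1 by (auto simp: act)
            from order_tendstoD(1)[OF tendsto_vec_nth[OF y] this] show ?thesis
              by eventually_elim (simp add: False eq)
          qed
        next
          case 2
          \<comment> \<open>Here the slack is \<open>t n * DF (dx, 0) $ k\<close> and the multiplier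
            is \<open>t n * dy $ k\<close>, so the conditions in \<open>critical\<close> scale to
            those of the KKT system for every \<open>n\<close>.\<close>
          then have "DF (dx, 0) $ k \<le> 0" "0 \<le> dy $ k" "dy $ k * DF (dx, 0) $ k = 0"
            using crit by (auto simp: critical_def)
          moreover have "k \<notin> E" "y0 $ k = 0" "k \<in> A" using 2 by (auto simp: act A_def)
          ultimately show ?thesis
            using t by (auto simp: u_def y_def mult_nonneg_nonpos less_imp_le)
        next
          case 3
          \<comment> \<open>Bound and multiplier are both 0 along the sequence, so it suffices that
            the constraint value stays negative.\<close>
          then have "k \<notin> E" "F x0 w0 $ k < 0" "y0 $ k = 0" "dy $ k = 0"
            using inactive[of k] crit by (auto simp: A_def critical_def)
          from order_tendstoD(2)[OF tendsto_vec_nth[OF Fx] this(2)] show ?thesis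
            by eventually_elim (simp add: u_def y_def 3 \<open>k \<notin> E\<close> \<open>y0 $ k = 0\<close> \<open>dy $ k = 0\<close>)
        qed
      qed
      then have "\<forall>\<^sub>F n in sequentially. (x n, y n) \<in> kkt_solutions E \<Phi> F (w0, v n, u n)"
        by (simp add: kkt_solutions_def v_def eventually_all_finite)
      \<comment> \<open>The calmness estimate divided by \<open>t n\<close> leaves the fixed number
        \<open>norm (dx, dy)\<close> on the left, while the right side tends to 0.\<close>
      with evV evW have "\<forall>\<^sub>F n in sequentially.
          norm (dx, dy) \<le> \<kappa> * norm (0::'w, v n /\<^sub>R t n, u n /\<^sub>R t n)"
      proof eventually_elim
        case (elim n)
        have "norm (t n *\<^sub>R (dx, dy)) \<le> \<kappa> * norm (t n *\<^sub>R (0::'w, v n /\<^sub>R t n, u n /\<^sub>R t n))"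
          using calm[OF elim(1,3,2)] t[of n] by (simp add: x_def y_def)
        then show ?case using t[of n] unfolding norm_scaleR by simp
      qed
      moreover have "(\<lambda>n. \<kappa> * norm (0::'w, v n /\<^sub>R t n, u n /\<^sub>R t n)) \<longlonglongrightarrow> \<kappa> * norm (0::'w, 0::'v, 0::real ^ 'm)"
        by (intro tendsto_intros qv qu)
      ultimately have "norm (dx, dy) \<le> \<kappa> * norm (0::'w, 0::'v, 0::real ^ 'm)"
        by (intro tendsto_lowerbound) auto
      then show "dx = 0 \<and> dy = 0" by (simp add: zero_prod_def[symmetric]) (simp add: zero_prod_def)
    qed
  }
qed

section \<open>Cones in coordinates, and \<open>S_Lag\<close> as the solution map of a KKT
  system\<close>

text \<open>Testing with \<open>- axis k 1\<close> yields the sign condition. Conversely, the sign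
  conditions make every term of the inner product nonpositive.\<close>

lemma K_polar_eq:
  "K_polar cp E \<nu> = {y \<in> coords (block cp \<nu>). \<forall>k\<in>block cp \<nu> - E. 0 \<le> y $ k}"
proof (intro equalityI subsetI)
  fix y assume y: "y \<in> K_polar cp E \<nu>"
  have "0 \<le> y $ k" if k: "k \<in> block cp \<nu> - E" for k
  proof -
    have "- axis k 1 \<in> K_cone cp E \<nu>"
      using k by (auto simp: K_cone_def coords_def axis_def)
    then have "inner y (- axis k 1) \<le> 0"
      using y unfolding K_polar_def polar_in_def by blast
    then show ?thesis by (simp add: inner_axis)
  qed
  then show "y \<in> {y \<in> coords (block cp \<nu>). \<forall>k\<in>block cp \<nu> - E. 0 \<le> y $ k}"
    using y by (auto simp: K_polar_def polar_in_def)
next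
  fix y assume y: "y \<in> {y \<in> coords (block cp \<nu>). \<forall>k\<in>block cp \<nu> - E. 0 \<le> y $ k}"
  have "inner y z \<le> 0" if z: "z \<in> K_cone cp E \<nu>" for z
    unfolding inner_vec_def inner_real_def
  proof (rule sum_nonpos)
    fix k
    show "y $ k * z $ k \<le> 0"
      using y z by (cases "k \<in> block cp \<nu>"; cases "k \<in> E")
        (auto simp: K_cone_def coords_def mult_nonneg_nonpos)
  qed
  then show "y \<in> K_polar cp E \<nu>" using y by (auto simp: K_polar_def polar_in_def)
qed

text \<open>The cone is a product of lines and half-lines, so the variational inequality splits into
  coordinates. Membership of the base point in the polar cone appears as
  \<open>0 \<le> y $ k\<close>.\<close>

lemma mem_normal_cone_K_polar_iff:
  "z \<in> normal_cone_in (coords (block cp \<nu>)) (K_polar cp E \<nu>) (subvec (block cp \<nu>) y) \<longleftrightarrow>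
     z \<in> coords (block cp \<nu>) \<and>
     (\<forall>k\<in>block cp \<nu>. if k \<in> E then z $ k = 0 else z $ k \<le> 0 \<and> 0 \<le> y $ k \<and> y $ k * z $ k = 0)"
    (is "?lhs \<longleftrightarrow> ?rhs")
proof
  let ?y = "subvec (block cp \<nu>) y"
  assume lhs: ?lhs
  then have y: "?y \<in> K_polar cp E \<nu>" and z: "z \<in> coords (block cp \<nu>)"
    and le: "\<And>z'. z' \<in> K_polar cp E \<nu> \<Longrightarrow> inner z (z' - ?y) \<le> 0"
    unfolding normal_cone_in_def by (auto split: if_splits)
  \<comment> \<open>One coordinate of the multiplier is moved by \<open>s\<close>. The choices 1 and
    -1 settle equality indices; 1 and \<open>- (y $ k)\<close> give sign and complementarity at the
    others.\<close>
  have test: "s * z $ k \<le> 0" if "k \<in> block cp \<nu>" "k \<in> E \<or> 0 \<le> y $ k + s" for k s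
  proof -
    have "?y + s *\<^sub>R axis k 1 \<in> K_polar cp E \<nu>"
      using y that by (auto simp: K_polar_eq coords_def subvec_def axis_def)
    from le[OF this] show ?thesis by (simp add: inner_axis)
  qed
  have "if k \<in> E then z $ k = 0 else z $ k \<le> 0 \<and> 0 \<le> y $ k \<and> y $ k * z $ k = 0"
    if k: "k \<in> block cp \<nu>" for k
  proof (cases "k \<in> E")
    case True
    then show ?thesis using test[OF k, of 1] test[OF k, of "-1"] by simp
  next
    case False
    then have "0 \<le> y $ k" using y k by (auto simp: K_polar_eq subvec_def)
    moreover from this have "z $ k \<le> 0" using test[OF k, of 1] by simp
    moreover have "0 \<le> y $ k * z $ k" using test[OF k, of "- (y $ k)"] by simp
    moreover from calculation have "y $ k * z $ k \<le> 0" by (intro mult_nonneg_nonpos)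
    ultimately show ?thesis using False by (metis antisym)
  qed
  with z show ?rhs by blast
next
  let ?y = "subvec (block cp \<nu>) y"
  assume rhs: ?rhs
  have "?y \<in> K_polar cp E \<nu>"
    using rhs by (auto simp: K_polar_eq coords_def subvec_def)
  moreover have "inner z (z' - ?y) \<le> 0" if z': "z' \<in> K_polar cp E \<nu>" for z'
    unfolding inner_vec_def inner_real_def
  proof (rule sum_nonpos)
    fix k
    show "z $ k * (z' - ?y) $ k \<le> 0"
    proof (cases "k \<in> block cp \<nu> - E")
      case True
      then have "z $ k * z' $ k \<le> 0" "y $ k * z $ k = 0"
        using rhs z' by (auto simp: K_polar_eq mult_nonpos_nonneg)
      then show ?thesis using True by (auto simp: subvec_def)
    next
      case False
      then have "z $ k = 0" using rhs by (cases "k \<in> block cp \<nu>") (auto simp: coords_def)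
      then show ?thesis by simp
    qed
  qed
  ultimately show ?lhs using rhs by (simp add: normal_cone_in_def)
qed

text \<open>Coordinate \<open>i\<close> is taken from the Lagrangian of its owner
  \<open>vp i\<close>. As the owners minimize different functions, the stacked vector is in general
  not the gradient of one function.\<close>

definition lagrangian_gradient ::
    "('n::finite \<Rightarrow> 'p) \<Rightarrow> ('m::finite \<Rightarrow> 'p) \<Rightarrow>
     ('p \<Rightarrow> real ^ 'n \<Rightarrow> 'w \<Rightarrow> real) \<Rightarrow> (real ^ 'n \<Rightarrow> 'w \<Rightarrow> real ^ 'm) \<Rightarrow>
     real ^ 'n \<Rightarrow> 'w \<Rightarrow> real ^ 'm \<Rightarrow> real ^ 'n" where
  "lagrangian_gradient vp cp f F x w y =
     (\<chi> i. grad (\<lambda>x. f (vp i) x w) x $ i +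
        (\<Sum>k\<in>block cp (vp i). jacobian (\<lambda>x. F x w) (at x) $ k $ i * y $ k))"

lemma transpose_submat_mult_nth:
  "(transpose (submat I J A) *v z) $ i = (if i \<in> J then \<Sum>k\<in>I. A $ k $ i * z $ k else 0)"
proof -
  have "(\<Sum>k\<in>UNIV. (if k \<in> I then A $ k $ i else 0) * z $ k) = (\<Sum>k\<in>I. A $ k $ i * z $ k)"
    by (rule sum.mono_neutral_cong_right) auto
  then show ?thesis
    by (simp add: transpose_def submat_def matrix_vector_mult_def)
qed

lemma submat_UNIV_mult_nth:
  "(submat I UNIV A *v z) $ k = (if k \<in> I then (A *v z) $ k else 0)"
  by (simp add: submat_def matrix_vector_mult_def)

text \<open>The blocks partition the coordinates, so conditions over all players become conditions
  over all coordinates. In the inclusion the normal vector is determined as the block of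
  \<open>F x w - u\<close>.\<close>

lemma S_Lag_eq_kkt_solutions:
  fixes vp :: "'n::finite \<Rightarrow> 'p" and cp :: "'m::finite \<Rightarrow> 'p"
    and F :: "real ^ 'n \<Rightarrow> real ^ 'd \<Rightarrow> real ^ 'm"
  shows "S_Lag vp cp E f F = kkt_solutions E (lagrangian_gradient vp cp f F) F"
proof -
  have "(x, y) \<in> S_Lag vp cp E f F (w, v, u) \<longleftrightarrow>
      (x, y) \<in> kkt_solutions E (lagrangian_gradient vp cp f F) F (w, v, u)" for x y w v u
  proof -
    \<comment> \<open>Padding makes the rows of other players zero, so each coordinate is
      constrained only by its owner.\<close>
    have comp: "(subvec (block vp \<nu>) (grad (\<lambda>x. f \<nu> x w) x)
         + transpose (submat (block cp \<nu>) (block vp \<nu>) (jacobian (\<lambda>x. F x w) (at x)))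
             *v subvec (block cp \<nu>) y - subvec (block vp \<nu>) v) $ i =
      (if vp i = \<nu> then (lagrangian_gradient vp cp f F x w y - v) $ i else 0)" for \<nu> i
      unfolding vector_add_component vector_minus_component transpose_submat_mult_nth
      by (simp add: subvec_def lagrangian_gradient_def block_def)
    have stat: "(\<forall>\<nu>. subvec (block vp \<nu>) (grad (\<lambda>x. f \<nu> x w) x)
         + transpose (submat (block cp \<nu>) (block vp \<nu>) (jacobian (\<lambda>x. F x w) (at x)))
             *v subvec (block cp \<nu>) y - subvec (block vp \<nu>) v = 0)
      \<longleftrightarrow> lagrangian_gradient vp cp f F x w y = v"
      unfolding vec_eq_iff comp by (auto simp: lagrangian_gradient_def)
    have zero_mem: "0 \<in> {- subvec I c + subvec I u + z |z. z \<in> N} \<longleftrightarrow> subvec I c - subvec I u \<in> N"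
      for I c and N :: "(real ^ 'm) set"
    proof -
      have "0 = - subvec I c + subvec I u + z \<longleftrightarrow> z = subvec I c - subvec I u" for z
        by (auto simp: algebra_simps)
      then show ?thesis by simp
    qed
    have "0 \<in> {- subvec (block cp \<nu>) (F x w) + subvec (block cp \<nu>) u + z |z.
              z \<in> normal_cone_in (coords (block cp \<nu>)) (K_polar cp E \<nu>) (subvec (block cp \<nu>) y)} \<longleftrightarrow>
      (\<forall>k\<in>block cp \<nu>. if k \<in> E then F x w $ k = u $ k
          else F x w $ k \<le> u $ k \<and> 0 \<le> y $ k \<and> y $ k * (F x w $ k - u $ k) = 0)" for \<nu>
      unfolding zero_mem unfolding mem_normal_cone_K_polar_iff by (simp add: coords_def subvec_def)
    then show ?thesis
      unfolding S_Lag_def kkt_solutions_def case_prod_conv mem_Collect_eq all_conj_distrib stat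
      by (simp add: block_def)
  qed
  then have "S_Lag vp cp E f F p = kkt_solutions E (lagrangian_gradient vp cp f F) F p" for p
    by (cases p) (rule set_eqI, simp only: split_paired_all)
  then show ?thesis by blast
qed

section \<open>Derivatives of the stacked gradient and the matrix \<open>G\<close>\<close>

text \<open>Fixing the second point of the two-point estimate at \<open>a\<close> leaves the
  definition of the Frechet derivative.\<close>

lemma strictly_differentiable_imp_differentiable:
  assumes "strictly_differentiable h a"
  shows "h differentiable at a"
proof -
  obtain D where D: "bounded_linear D" and
    est: "\<And>\<epsilon>. \<epsilon> > 0 \<Longrightarrow> \<exists>\<delta>>0. \<forall>z\<in>ball a \<delta>. \<forall>z'\<in>ball a \<delta>. norm (h z - h z' - D (z - z')) \<le> \<epsilon> * norm (z - z')"
    using assms unfolding strictly_differentiable_def by metis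
  have "(h has_derivative D) (at a)"
    unfolding has_derivative_at_alt
  proof (intro conjI allI impI D)
    fix \<epsilon> :: real assume "\<epsilon> > 0"
    from est[OF this] obtain \<delta> where "\<delta> > 0"
      "\<And>z z'. z \<in> ball a \<delta> \<Longrightarrow> z' \<in> ball a \<delta> \<Longrightarrow> norm (h z - h z' - D (z - z')) \<le> \<epsilon> * norm (z - z')"
      by blast
    then show "\<exists>d>0. \<forall>y. norm (y - a) < d \<longrightarrow> norm (h y - h a - D (y - a)) \<le> \<epsilon> * norm (y - a)"
      by (intro exI[of _ \<delta>]) (simp add: dist_norm norm_minus_commute)
  qed
  then show ?thesis by (rule differentiableI)
qed

lemma grad_eq:
  assumes "(h has_derivative D) (at x)"
  shows "grad h x = (\<chi> i. D (axis i 1))"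
  by (simp add: grad_def frechet_derivative_at[OF assms, symmetric])

lemma grad_player_lagrangian:
  assumes "\<theta> \<nu> differentiable at x" "g differentiable at x"
  shows "grad (\<lambda>x. player_lagrangian cp \<theta> g \<nu> x y) x $ i =
    grad (\<theta> \<nu>) x $ i + (\<Sum>k\<in>block cp \<nu>. jacobian g (at x) $ k $ i * y $ k)"
proof -
  let ?J = "jacobian g (at x)"
  have eq: "player_lagrangian cp \<theta> g \<nu> x y = \<theta> \<nu> x + (\<Sum>k\<in>block cp \<nu>. g x $ k * y $ k)" for x
  proof -
    have "inner (subvec (block cp \<nu>) y) (subvec (block cp \<nu>) (g x)) = (\<Sum>k\<in>block cp \<nu>. g x $ k * y $ k)"
      unfolding inner_vec_def subvec_def by (rule sum.mono_neutral_cong_right) auto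
    then show ?thesis by (simp add: player_lagrangian_def)
  qed
  have \<theta>: "(\<theta> \<nu> has_derivative frechet_derivative (\<theta> \<nu>) (at x)) (at x)"
    using assms(1) by (simp add: frechet_derivative_works)
  have "(g has_derivative (\<lambda>h. ?J *v h)) (at x)" using assms(2) by (simp add: jacobian_works)
  from bounded_linear.has_derivative[OF bounded_linear_vec_nth this]
  have g: "((\<lambda>x. g x $ k) has_derivative (\<lambda>h. (?J *v h) $ k)) (at x)" for k .
  have "((\<lambda>x. player_lagrangian cp \<theta> g \<nu> x y) has_derivative
      (\<lambda>h. frechet_derivative (\<theta> \<nu>) (at x) h + (\<Sum>k\<in>block cp \<nu>. (?J *v h) $ k * y $ k))) (at x)"
    unfolding eq by (intro derivative_intros \<theta> g)
  from grad_eq[OF this] show ?thesis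
    by (simp add: grad_eq[OF \<theta>] matrix_vector_mult_basis column_def)
qed

lemma has_derivative_fixed_snd:
  assumes "((\<lambda>(x, w). h x w) has_derivative D) (at (x0, w0))"
  shows "((\<lambda>x. h x w0) has_derivative (\<lambda>dx. D (dx, 0))) (at x0)"
  using has_derivative_compose[OF has_derivative_Pair[OF has_derivative_ident has_derivative_const], of "\<lambda>(x, w). h x w" D x0 w0 UNIV] assms
  by simp

lemma has_derivative_vec_lambda:
  fixes h :: "'i::finite \<Rightarrow> 'a::real_normed_vector \<Rightarrow> real"
  assumes "\<And>i. (h i has_derivative D i) F"
  shows "((\<lambda>x. \<chi> i. h i x) has_derivative (\<lambda>d. \<chi> i. D i d)) F"
proof -
  have sum: "(\<chi> i. c i) = (\<Sum>i\<in>UNIV. c i *\<^sub>R axis i 1)" for c :: "'i \<Rightarrow> real"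
    by (simp add: vec_eq_iff axis_def if_distrib cong: if_cong)
  show ?thesis unfolding sum by (intro derivative_intros assms)
qed

lemma jacobian_mult:
  fixes h :: "real ^ 'n::finite \<Rightarrow> real ^ 'm::finite"
  assumes "(h has_derivative D) (at x)"
  shows "jacobian h (at x) *v d = D d"
proof -
  have "(h has_derivative (\<lambda>d. jacobian h (at x) *v d)) (at x)"
    by (rule iffD1[OF jacobian_works differentiableI[OF assms]])
  from has_derivative_unique[OF this assms] show ?thesis by metis
qed

text \<open>The product rule splits the multiplier term in two: the Jacobian at the reference point
  applied to \<open>dy\<close>, and the derivative of the Jacobian weighted by \<open>y0\<close>.
  The latter, with \<open>Df\<close>, forms the second-order part of the Lagrangians.\<close>

lemma has_derivative_lagrangian_gradient:
  assumes f: "\<And>\<nu>. ((\<lambda>(x, w). grad (\<lambda>x. f \<nu> x w) x) has_derivative Df \<nu>) (at (x0, w0))"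
    and J: "((\<lambda>(x, w). jacobian (\<lambda>x. F x w) (at x)) has_derivative DJ) (at (x0, w0))"
  shows "((\<lambda>(x, w, y). lagrangian_gradient vp cp f F x w y) has_derivative
    (\<lambda>(dx, dw, dy). \<chi> i. Df (vp i) (dx, dw) $ i + (\<Sum>k\<in>block cp (vp i).
       jacobian (\<lambda>x. F x w0) (at x0) $ k $ i * dy $ k + DJ (dx, dw) $ k $ i * y0 $ k)))
    (at (x0, w0, y0))"
proof -
  have pair: "((\<lambda>p. (fst p, fst (snd p))) has_derivative (\<lambda>d. (fst d, fst (snd d)))) (at (x0, w0, y0))"
    by (intro derivative_intros)
  have f': "((\<lambda>p. grad (\<lambda>x. f \<nu> x (fst (snd p))) (fst p) $ i) has_derivative
      (\<lambda>d. Df \<nu> (fst d, fst (snd d)) $ i)) (at (x0, w0, y0))" for \<nu> i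
    using bounded_linear.has_derivative[OF bounded_linear_vec_nth
        has_derivative_compose[OF pair, of "\<lambda>(x, w). grad (\<lambda>x. f \<nu> x w) x" "Df \<nu>"]] f[of \<nu>]
    by simp
  have J': "((\<lambda>p. jacobian (\<lambda>x. F x (fst (snd p))) (at (fst p)) $ k $ i) has_derivative
      (\<lambda>d. DJ (fst d, fst (snd d)) $ k $ i)) (at (x0, w0, y0))" for k i
    using bounded_linear.has_derivative[OF bounded_linear_vec_nth
        bounded_linear.has_derivative[OF bounded_linear_vec_nth
        has_derivative_compose[OF pair, of "\<lambda>(x, w). jacobian (\<lambda>x. F x w) (at x)" DJ]]] J
    by simp
  have y': "((\<lambda>p. snd (snd p) $ k) has_derivative (\<lambda>d. snd (snd d) $ k)) (at (x0, w0, y0))" for k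
    by (intro bounded_linear.has_derivative[OF bounded_linear_vec_nth] derivative_intros)
  have Jy: "((\<lambda>p. jacobian (\<lambda>x. F x (fst (snd p))) (at (fst p)) $ k $ i * snd (snd p) $ k) has_derivative
      (\<lambda>d. jacobian (\<lambda>x. F x w0) (at x0) $ k $ i * snd (snd d) $ k
        + DJ (fst d, fst (snd d)) $ k $ i * y0 $ k)) (at (x0, w0, y0))" for k i
    using has_derivative_mult[OF J' y'] by simp
  show ?thesis
    unfolding lagrangian_gradient_def case_prod_unfold
    by (intro has_derivative_vec_lambda has_derivative_add has_derivative_sum f' Jy)
qed

text \<open>Identifies that second-order part, along \<open>dw = 0\<close>, with the action of
  \<open>G\<close>. It is computed row by row because the Lagrangian changes with the owner of the
  row.\<close>

lemma G_matrix_mult_nth: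
  fixes f :: "'p \<Rightarrow> real ^ 'n::finite \<Rightarrow> 'w::real_normed_vector \<Rightarrow> real"
    and F :: "real ^ 'n \<Rightarrow> 'w \<Rightarrow> real ^ 'm::finite"
  assumes U: "open U" "(x0, w0) \<in> U"
    and f_diff: "\<And>\<nu> x. (x, w0) \<in> U \<Longrightarrow> (\<lambda>x. f \<nu> x w0) differentiable at x"
    and F_diff: "\<And>x. (x, w0) \<in> U \<Longrightarrow> (\<lambda>x. F x w0) differentiable at x"
    and f: "\<And>\<nu>. ((\<lambda>(x, w). grad (\<lambda>x. f \<nu> x w) x) has_derivative Df \<nu>) (at (x0, w0))"
    and J: "((\<lambda>(x, w). jacobian (\<lambda>x. F x w) (at x)) has_derivative DJ) (at (x0, w0))"
  shows "(G_matrix vp cp (\<lambda>\<nu> x. f \<nu> x w0) (\<lambda>x. F x w0) x0 y0 *v dx) $ i =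
    Df (vp i) (dx, 0) $ i + (\<Sum>k\<in>block cp (vp i). DJ (dx, 0) $ k $ i * y0 $ k)"
proof -
  define \<nu> where "\<nu> = vp i"
  let ?H = "\<lambda>x. \<chi> j. grad (\<lambda>x. f \<nu> x w0) x $ j +
      (\<Sum>k\<in>block cp \<nu>. jacobian (\<lambda>x. F x w0) (at x) $ k $ j * y0 $ k)"
  let ?L = "grad (\<lambda>x. player_lagrangian cp (\<lambda>\<nu> x. f \<nu> x w0) (\<lambda>x. F x w0) \<nu> x y0)"
  note f' = has_derivative_fixed_snd[OF f]
  note J' = has_derivative_fixed_snd[OF J]
  have H: "(?H has_derivative (\<lambda>d. \<chi> j. Df \<nu> (d, 0) $ j +
      (\<Sum>k\<in>block cp \<nu>. DJ (d, 0) $ k $ j * y0 $ k))) (at x0)"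
    by (intro has_derivative_vec_lambda derivative_intros
        bounded_linear.has_derivative[OF bounded_linear_vec_nth] f' J')
  \<comment> \<open>The gradient formula is differentiated once more, so it has to hold on an open
    set around \<open>x0\<close>. The slice of \<open>U\<close> at \<open>w0\<close> is such a
    set.\<close>
  have "open ((\<lambda>x. (x, w0)) -` U)"
    by (intro open_vimage U continuous_intros)
  moreover have "x0 \<in> (\<lambda>x. (x, w0)) -` U" using U by simp
  moreover have "?H x = ?L x" if "x \<in> (\<lambda>x. (x, w0)) -` U" for x
    using that grad_player_lagrangian[where \<theta> = "\<lambda>\<nu> x. f \<nu> x w0" and g = "\<lambda>x. F x w0"] f_diff F_diff
    by (simp add: vec_eq_iff)
  ultimately have "(?L has_derivative (\<lambda>d. \<chi> j. Df \<nu> (d, 0) $ j +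
      (\<Sum>k\<in>block cp \<nu>. DJ (d, 0) $ k $ j * y0 $ k))) (at x0)"
    using has_derivative_transform_within_open[OF H] by blast
  from jacobian_mult[OF this, of dx]
  have "(jacobian ?L (at x0) *v dx) $ i =
      Df \<nu> (dx, 0) $ i + (\<Sum>k\<in>block cp \<nu>. DJ (dx, 0) $ k $ i * y0 $ k)" by simp
  then show ?thesis by (simp add: G_matrix_def matrix_vector_mult_def \<nu>_def)
qed

section \<open>Complementarity, index sets and padded submatrices\<close>

text \<open>A sum of terms of one sign vanishes only if each term does.\<close>

lemma complementary_iff:
  "complementary a b \<longleftrightarrow> (\<forall>k. a $ k \<le> 0 \<and> 0 \<le> b $ k \<and> b $ k * a $ k = 0)"
proof -
  have "inner a b = 0 \<longleftrightarrow> (\<forall>k. b $ k * a $ k = 0)" if "\<forall>k. a $ k \<le> 0" "\<forall>k. 0 \<le> b $ k"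
  proof -
    have "inner a b = - (\<Sum>k\<in>UNIV. - (b $ k * a $ k))"
      by (simp add: inner_vec_def sum_negf mult.commute)
    moreover have "(\<Sum>k\<in>UNIV. - (b $ k * a $ k)) = 0 \<longleftrightarrow> (\<forall>k\<in>UNIV. - (b $ k * a $ k) = 0)"
      using that by (intro sum_nonneg_eq_0_iff) (auto simp: mult_nonneg_nonpos)
    ultimately show ?thesis by simp
  qed
  then show ?thesis unfolding complementary_def by blast
qed

lemma alpha_set_eq: "alpha_set cp E g x y \<nu> = block cp \<nu> \<inter> strongly_active E (g x) y"
  by (auto simp: alpha_set_def strongly_active_def)

lemma beta_set_eq: "beta_set cp E g x y \<nu> = block cp \<nu> \<inter> weakly_active E (g x) y"
  by (auto simp: beta_set_def weakly_active_def)

text \<open>The rows added to the submatrix meet zero entries of \<open>z\<close>. This allows the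
  index sets of a player to be enlarged to its whole block.\<close>

lemma transpose_submat_mult_mono:
  assumes "z \<in> coords I" "I \<subseteq> K"
  shows "transpose (submat I J A) *v z = transpose (submat K J A) *v z"
proof -
  have "(\<Sum>k\<in>I. A $ k $ i * z $ k) = (\<Sum>k\<in>K. A $ k $ i * z $ k)" for i
    using assms by (intro sum.mono_neutral_left) (auto simp: coords_def)
  then show ?thesis unfolding vec_eq_iff transpose_submat_mult_nth by simp
qed

lemma stack_transpose_submat_nth:
  assumes "\<And>\<nu>. da \<nu> \<in> coords (I \<nu>)" "\<And>\<nu>. db \<nu> \<in> coords (J \<nu>)"
    and "\<And>\<nu>. I \<nu> \<subseteq> block cp \<nu>" "\<And>\<nu>. J \<nu> \<subseteq> block cp \<nu>"
  shows "stack vp (\<lambda>\<nu>. transpose (submat (I \<nu>) (block vp \<nu>) A) *v da \<nu>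
                      + transpose (submat (J \<nu>) (block vp \<nu>) A) *v db \<nu>) $ i =
    (\<Sum>k\<in>block cp (vp i). A $ k $ i * (da (cp k) $ k + db (cp k) $ k))"
proof -
  have "transpose (submat (I \<nu>) (block vp \<nu>) A) *v da \<nu> + transpose (submat (J \<nu>) (block vp \<nu>) A) *v db \<nu>
      = transpose (submat (block cp \<nu>) (block vp \<nu>) A) *v (da \<nu> + db \<nu>)" for \<nu>
    by (simp only: transpose_submat_mult_mono[OF assms(1,3)] transpose_submat_mult_mono[OF assms(2,4)]
        matrix_vector_right_distrib)
  then show ?thesis
    by (simp only: stack_def vec_lambda_beta transpose_submat_mult_nth) (simp add: block_def)
qed

section \<open>From one multiplier direction to the families over \<alpha> and \<beta>\<close>

text \<open>A critical \<open>dy\<close> corresponds to families \<open>da\<close>,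
  \<open>db\<close> with the prescribed supports: blocks of different players are disjoint, the sets
  \<alpha> and \<beta> of one player are disjoint, and \<open>dy\<close> vanishes elsewhere.\<close>

theorem theorem2p4:
  fixes vp :: "'n::finite \<Rightarrow> 'p::finite"
    and cp :: "'m::finite \<Rightarrow> 'p"
    and E :: "'m set"
    and f :: "'p \<Rightarrow> real ^ 'n \<Rightarrow> real ^ 'd::finite \<Rightarrow> real"
    and F :: "real ^ 'n \<Rightarrow> real ^ 'd \<Rightarrow> real ^ 'm"
    and x0 :: "real ^ 'n" and y0 :: "real ^ 'm" and w0 :: "real ^ 'd"
    and U :: "((real ^ 'n) \<times> (real ^ 'd)) set"
  defines "\<theta> \<equiv> \<lambda>\<nu> x. f \<nu> x w0"
    and "g \<equiv> \<lambda>x. F x w0"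
  defines "\<alpha> \<equiv> alpha_set cp E g x0 y0"
    and "\<beta> \<equiv> beta_set cp E g x0 y0"
    and "G \<equiv> G_matrix vp cp \<theta> g x0 y0"
    and "Jg \<equiv> jacobian g (at x0)"
  assumes sol: "(x0, y0) \<in> S_Lag vp cp E f F (w0, 0, 0)"
    and nbhd: "open U" "(x0, w0) \<in> U"
    and f_twice: "\<And>\<nu> x w. (x, w) \<in> U \<Longrightarrow>
        (\<lambda>x. f \<nu> x w) differentiable at x \<and> grad (\<lambda>x. f \<nu> x w) differentiable at x"
    and F_twice: "\<And>x w. (x, w) \<in> U \<Longrightarrow>
        (\<lambda>x. F x w) differentiable at x \<and>
        (\<lambda>x. jacobian (\<lambda>x. F x w) (at x)) differentiable at x"
    and f_strict: "\<And>\<nu> a. a \<in> U \<Longrightarrow>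
        strictly_differentiable (\<lambda>(x, w). f \<nu> x w) a \<and>
        strictly_differentiable (\<lambda>(x, w). grad (\<lambda>x. f \<nu> x w) x) a"
    and F_strict: "\<And>a. a \<in> U \<Longrightarrow>
        strictly_differentiable (\<lambda>(x, w). F x w) a \<and>
        strictly_differentiable (\<lambda>(x, w). jacobian (\<lambda>x. F x w) (at x)) a"
  shows "isolated_calmness (S_Lag vp cp E f F) (w0, 0, 0) (x0, y0) \<longleftrightarrow>
    (\<forall>(dx :: real ^ 'n) (da :: 'p \<Rightarrow> real ^ 'm) (db :: 'p \<Rightarrow> real ^ 'm).
       (\<forall>\<nu>. da \<nu> \<in> coords (\<alpha> \<nu>) \<and> db \<nu> \<in> coords (\<beta> \<nu>)) \<longrightarrow>
       G *v dx
         + stack vp (\<lambda>\<nu>. transpose (submat (\<alpha> \<nu>) (block vp \<nu>) Jg) *v da \<nu>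
                        + transpose (submat (\<beta> \<nu>) (block vp \<nu>) Jg) *v db \<nu>) = 0 \<and>
       (\<forall>\<nu>. submat (\<alpha> \<nu>) UNIV Jg *v dx = 0) \<and>
       (\<forall>\<nu>. complementary (submat (\<beta> \<nu>) UNIV Jg *v dx) (db \<nu>)) \<longrightarrow>
       dx = 0 \<and> (\<forall>\<nu>. da \<nu> = 0 \<and> db \<nu> = 0))"
proof -
  define A where "A = strongly_active E (F x0 w0) y0"
  define B where "B = weakly_active E (F x0 w0) y0"
  have \<alpha>: "\<alpha> \<nu> = block cp \<nu> \<inter> A" and \<beta>: "\<beta> \<nu> = block cp \<nu> \<inter> B" for \<nu>
    by (simp_all add: \<alpha>_def \<beta>_def g_def A_def B_def alpha_set_eq beta_set_eq)
  have disjoint: "k \<notin> B" if "k \<in> A" for k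
    using that by (auto simp: A_def B_def strongly_active_def weakly_active_def)
  have "\<exists>Df. ((\<lambda>(x, w). grad (\<lambda>x. f \<nu> x w) x) has_derivative Df) (at (x0, w0))" for \<nu>
    using f_strict[OF nbhd(2), of \<nu>] strictly_differentiable_imp_differentiable
    unfolding differentiable_def by blast
  then obtain Df where
    Df: "\<And>\<nu>. ((\<lambda>(x, w). grad (\<lambda>x. f \<nu> x w) x) has_derivative Df \<nu>) (at (x0, w0))"
    by metis
  obtain DJ where DJ: "((\<lambda>(x, w). jacobian (\<lambda>x. F x w) (at x)) has_derivative DJ) (at (x0, w0))"
    using F_strict[OF nbhd(2)] strictly_differentiable_imp_differentiable
    unfolding differentiable_def by blast
  obtain DF where DF: "((\<lambda>(x, w). F x w) has_derivative DF) (at (x0, w0))"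
    using F_strict[OF nbhd(2)] strictly_differentiable_imp_differentiable
    unfolding differentiable_def by blast
  have DF_eq: "DF (dx, 0) = Jg *v dx" for dx
    unfolding Jg_def g_def using jacobian_mult[OF has_derivative_fixed_snd[OF DF]] by simp
  \<comment> \<open>The multiplier part of linearised stationarity; \<open>G *v dx\<close> is the
    remaining part.\<close>
  define R where "R dy = (\<chi> i. \<Sum>k\<in>block cp (vp i). Jg $ k $ i * dy $ k)" for dy
  have G: "(G *v dx) $ i = Df (vp i) (dx, 0) $ i + (\<Sum>k\<in>block cp (vp i). DJ (dx, 0) $ k $ i * y0 $ k)"
    for dx i
    unfolding G_def \<theta>_def g_def
    by (rule G_matrix_mult_nth[OF nbhd _ _ Df DJ]) (use f_twice F_twice in blast)+
  have "isolated_calmness (S_Lag vp cp E f F) (w0, 0, 0) (x0, y0) \<longleftrightarrow>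
    (\<forall>dx dy. (\<chi> i. Df (vp i) (dx, 0) $ i + (\<Sum>k\<in>block cp (vp i).
       Jg $ k $ i * dy $ k + DJ (dx, 0) $ k $ i * y0 $ k)) = 0 \<and>
      critical E (F x0 w0) y0 (DF (dx, 0)) dy \<longrightarrow> dx = 0 \<and> dy = 0)"
    using isolated_calmness_kkt_iff[OF _ has_derivative_lagrangian_gradient[OF Df DJ] DF] sol
    unfolding S_Lag_eq_kkt_solutions Jg_def g_def by simp
  moreover have "(\<chi> i. Df (vp i) (dx, 0) $ i + (\<Sum>k\<in>block cp (vp i).
       Jg $ k $ i * dy $ k + DJ (dx, 0) $ k $ i * y0 $ k)) = G *v dx + R dy" for dx dy
    by (simp add: vec_eq_iff G R_def sum.distrib)
  ultimately have calm: "isolated_calmness (S_Lag vp cp E f F) (w0, 0, 0) (x0, y0) \<longleftrightarrow>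
    (\<forall>dx dy. G *v dx + R dy = 0 \<and> critical E (F x0 w0) y0 (Jg *v dx) dy \<longrightarrow> dx = 0 \<and> dy = 0)"
    by (simp add: DF_eq)
  have stack: "stack vp (\<lambda>\<nu>. transpose (submat (\<alpha> \<nu>) (block vp \<nu>) Jg) *v da \<nu>
       + transpose (submat (\<beta> \<nu>) (block vp \<nu>) Jg) *v db \<nu>) = R (\<chi> k. da (cp k) $ k + db (cp k) $ k)"
    if "\<And>\<nu>. da \<nu> \<in> coords (\<alpha> \<nu>)" "\<And>\<nu>. db \<nu> \<in> coords (\<beta> \<nu>)" for da db
    using stack_transpose_submat_nth[of da \<alpha> db \<beta> cp vp Jg] that
    by (simp add: vec_eq_iff R_def \<alpha> \<beta>)
  have critical_iff: "critical E (F x0 w0) y0 (Jg *v dx) (\<chi> k. da (cp k) $ k + db (cp k) $ k) \<longleftrightarrow>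
      (\<forall>\<nu>. submat (\<alpha> \<nu>) UNIV Jg *v dx = 0) \<and>
      (\<forall>\<nu>. complementary (submat (\<beta> \<nu>) UNIV Jg *v dx) (db \<nu>))"
    if "\<And>\<nu>. da \<nu> \<in> coords (\<alpha> \<nu>)" "\<And>\<nu>. db \<nu> \<in> coords (\<beta> \<nu>)" for dx da db
  proof -
    \<comment> \<open>These zeros come from the supports: on \<open>B\<close> the recombined vector
      is given by \<open>db\<close> alone, and off \<open>A \<union> B\<close> it vanishes.\<close>
    have zero: "k \<notin> A \<Longrightarrow> da (cp k) $ k = 0" "k \<notin> B \<or> cp k \<noteq> \<nu> \<Longrightarrow> db \<nu> $ k = 0" for k \<nu>
      using that by (auto simp: coords_def \<alpha> \<beta> block_def)
    have "(\<forall>\<nu>. submat (\<alpha> \<nu>) UNIV Jg *v dx = 0) \<longleftrightarrow> (\<forall>k\<in>A. (Jg *v dx) $ k = 0)"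
      by (auto simp: vec_eq_iff submat_UNIV_mult_nth \<alpha> block_def)
    moreover have "(\<forall>\<nu>. complementary (submat (\<beta> \<nu>) UNIV Jg *v dx) (db \<nu>)) \<longleftrightarrow>
        (\<forall>k\<in>B. (Jg *v dx) $ k \<le> 0 \<and> 0 \<le> db (cp k) $ k \<and> db (cp k) $ k * (Jg *v dx) $ k = 0)"
      unfolding complementary_iff submat_UNIV_mult_nth
    proof (intro iffI allI ballI)
      fix k assume L: "\<forall>\<nu> k. (if k \<in> \<beta> \<nu> then (Jg *v dx) $ k else 0) \<le> 0 \<and> 0 \<le> db \<nu> $ k \<and>
          db \<nu> $ k * (if k \<in> \<beta> \<nu> then (Jg *v dx) $ k else 0) = 0" and "k \<in> B"
      then have "k \<in> \<beta> (cp k)" by (simp add: \<beta> block_def)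
      then show "(Jg *v dx) $ k \<le> 0 \<and> 0 \<le> db (cp k) $ k \<and> db (cp k) $ k * (Jg *v dx) $ k = 0"
        using L[rule_format, of k "cp k"] by simp
    next
      fix \<nu> k assume R: "\<forall>k\<in>B. (Jg *v dx) $ k \<le> 0 \<and> 0 \<le> db (cp k) $ k \<and>
          db (cp k) $ k * (Jg *v dx) $ k = 0"
      show "(if k \<in> \<beta> \<nu> then (Jg *v dx) $ k else 0) \<le> 0 \<and> 0 \<le> db \<nu> $ k \<and>
          db \<nu> $ k * (if k \<in> \<beta> \<nu> then (Jg *v dx) $ k else 0) = 0"
      proof (cases "k \<in> \<beta> \<nu>")
        case True
        then show ?thesis using R by (auto simp: \<beta> block_def)
      next
        case False
        then have "k \<notin> B \<or> cp k \<noteq> \<nu>" by (auto simp: \<beta> block_def)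
        with False zero(2) show ?thesis by simp
      qed
    qed
    moreover have "(\<chi> k. da (cp k) $ k + db (cp k) $ k) $ k = db (cp k) $ k" if "k \<in> B" for k
      using that zero(1)[of k] disjoint[of k] by auto
    moreover have "(\<chi> k. da (cp k) $ k + db (cp k) $ k) $ k = 0" if "k \<notin> A \<union> B" for k
      using that zero by simp
    ultimately show ?thesis
      unfolding critical_def A_def[symmetric] B_def[symmetric] by (metis (no_types, lifting))
  qed
  show ?thesis
    unfolding calm
  proof (intro iffI allI impI)
    fix dx da db
    assume crit: "\<forall>dx dy. G *v dx + R dy = 0 \<and> critical E (F x0 w0) y0 (Jg *v dx) dy \<longrightarrow> dx = 0 \<and> dy = 0"
      and coords: "\<forall>\<nu>. da \<nu> \<in> coords (\<alpha> \<nu>) \<and> db \<nu> \<in> coords (\<beta> \<nu>)"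
      and dir: "G *v dx + stack vp (\<lambda>\<nu>. transpose (submat (\<alpha> \<nu>) (block vp \<nu>) Jg) *v da \<nu>
                        + transpose (submat (\<beta> \<nu>) (block vp \<nu>) Jg) *v db \<nu>) = 0 \<and>
       (\<forall>\<nu>. submat (\<alpha> \<nu>) UNIV Jg *v dx = 0) \<and>
       (\<forall>\<nu>. complementary (submat (\<beta> \<nu>) UNIV Jg *v dx) (db \<nu>))"
    have da: "da \<nu> \<in> coords (\<alpha> \<nu>)" and db: "db \<nu> \<in> coords (\<beta> \<nu>)" for \<nu> using coords by auto
    have dx: "dx = 0" and dy: "(\<chi> k. da (cp k) $ k + db (cp k) $ k) = 0"
      using crit dir unfolding stack[OF da db] critical_iff[OF da db, symmetric] by blast+
    have "da \<nu> $ k = 0 \<and> db \<nu> $ k = 0" for \<nu> k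
    proof -
      \<comment> \<open>At each coordinate at most one of the two summands can be nonzero, so both
        vanish with the sum.\<close>
      have "da (cp k) $ k + db (cp k) $ k = 0" using dy by (simp add: vec_eq_iff)
      then show ?thesis
        using da[of \<nu>] db[of \<nu>] disjoint[of k]
        by (cases "cp k = \<nu>"; cases "k \<in> A") (auto simp: coords_def \<alpha> \<beta> block_def)
    qed
    with dx show "dx = 0 \<and> (\<forall>\<nu>. da \<nu> = 0 \<and> db \<nu> = 0)" by (simp add: vec_eq_iff)
  next
    fix dx dy
    assume impl: "\<forall>dx da db. (\<forall>\<nu>. da \<nu> \<in> coords (\<alpha> \<nu>) \<and> db \<nu> \<in> coords (\<beta> \<nu>)) \<longrightarrow>
       G *v dx
         + stack vp (\<lambda>\<nu>. transpose (submat (\<alpha> \<nu>) (block vp \<nu>) Jg) *v da \<nu>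
                        + transpose (submat (\<beta> \<nu>) (block vp \<nu>) Jg) *v db \<nu>) = 0 \<and>
       (\<forall>\<nu>. submat (\<alpha> \<nu>) UNIV Jg *v dx = 0) \<and>
       (\<forall>\<nu>. complementary (submat (\<beta> \<nu>) UNIV Jg *v dx) (db \<nu>)) \<longrightarrow>
       dx = 0 \<and> (\<forall>\<nu>. da \<nu> = 0 \<and> db \<nu> = 0)"
      and dir: "G *v dx + R dy = 0 \<and> critical E (F x0 w0) y0 (Jg *v dx) dy"
    \<comment> \<open>Restricting \<open>dy\<close> loses nothing, because \<open>critical\<close>
      makes it zero off \<open>A \<union> B\<close>.\<close>
    define da where "da \<nu> = subvec (\<alpha> \<nu>) dy" for \<nu>
    define db where "db \<nu> = subvec (\<beta> \<nu>) dy" for \<nu>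
    have da: "da \<nu> \<in> coords (\<alpha> \<nu>)" and db: "db \<nu> \<in> coords (\<beta> \<nu>)" for \<nu>
      by (simp_all add: da_def db_def coords_def subvec_def)
    have "dy $ k = 0" if "k \<notin> A \<union> B" for k
      using dir that by (auto simp: critical_def A_def B_def)
    then have dy: "(\<chi> k. da (cp k) $ k + db (cp k) $ k) = dy"
      using disjoint by (auto simp: vec_eq_iff da_def db_def subvec_def \<alpha> \<beta> block_def)
    have "dx = 0 \<and> (\<forall>\<nu>. da \<nu> = 0 \<and> db \<nu> = 0)"
      using impl[rule_format, of da db dx] dir
      unfolding stack[OF da db] critical_iff[OF da db, symmetric] dy using da db by blast
    then show "dx = 0 \<and> dy = 0" using dy by (auto simp: vec_eq_iff)
  qed
qed

end
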